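(* Let $\mathbf P=(P,\leq,{}')$ be a downward directed poset with a unary operation $'$ and let $\mathbb D(\mathbf P)=(P,\sqcap,{}')$ be a meet-directoid assigned to $\mathbf P$. Then $\mathbf P$ is a pseudo-Kleene poset if and only if $\mathbb D(\mathbf P)$ satisfies, for all $x,y,z,w\in P$, the identities (1) $x''=x$, (2) $(x\sqcap y)'\sqcap y'=y'$, (3) $(z\sqcap x)\sqcap(z\sqcap x')\leq(w\sqcup y)\sqcup(w\sqcup y')$.
   Context: Let $(P,\leq)$ be a poset. For $A,B\subseteq P$ write $A\leq B$ if $x\leq y$ for all $x\in A$, $y\in B$. For $a,b\in P$ put $L(a,b)=\{x\in P\mid x\leq a,\ x\leq b\}$ and $U(a,b)=\{x\in P\mid a\leq x,\ b\leq x\}$. A unary operation $'$ on $P$ is antitone if $x\leq y$ implies $y'\leq x'$, and an involution if $x''=x$ for all $x$. A pseudo-Kleene poset is a poset $(P,\leq,{}')$ with an antitone involution satisfying $L(x,x')\leq U(y,y')$ for all $x,y\in P$. A poset is downward directed if $L(x,y)\neq\emptyset$ for all $x,y$. A meet-directoid assigned to a downward directed poset $(P,\leq)$ is a groupoid $(P,\sqcap)$ such that $x\sqcap y=x\wedge y$ (the smaller of the two elements) if $x,y$ are comparable, and $x\sqcap y=y\sqcap x$ is an arbitrarily chosen element of $L(x,y)$ if $x,y$ are incomparable. One has $x\leq y$ if and only if $x\sqcap y=x$. The unary operation $'$ is carried along, and $x\sqcup y:=(x'\sqcap y')'$. *)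

theory Defs
  imports Main
begin

definition lower_cone :: "'a::order \<Rightarrow> 'a \<Rightarrow> 'a set" where
  "lower_cone a b = {x. x \<le> a \<and> x \<le> b}"

definition upper_cone :: "'a::order \<Rightarrow> 'a \<Rightarrow> 'a set" where
  "upper_cone a b = {x. a \<le> x \<and> b \<le> x}"

definition set_le :: "'a::order set \<Rightarrow> 'a set \<Rightarrow> bool" where
  "set_le A B \<longleftrightarrow> (\<forall>x\<in>A. \<forall>y\<in>B. x \<le> y)"

definition involution :: "('a \<Rightarrow> 'a) \<Rightarrow> bool" where
  "involution c \<longleftrightarrow> (\<forall>x. c (c x) = x)"

definition pseudo_Kleene_poset :: "('a::order \<Rightarrow> 'a) \<Rightarrow> bool" where
  "pseudo_Kleene_poset c \<longleftrightarrow>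
     antimono c \<and> involution c \<and>
     (\<forall>x y. set_le (lower_cone x (c x)) (upper_cone y (c y)))"

definition downward_directed :: "'a::order itself \<Rightarrow> bool" where
  "downward_directed _ \<longleftrightarrow> (\<forall>x y :: 'a. lower_cone x y \<noteq> {})"

text \<open>The directoid is not determined by the order: any operation meeting these conditions
  counts, the choice being free (up to commutativity) on incomparable pairs.\<close>

definition assigned_meet_directoid :: "('a::order \<Rightarrow> 'a \<Rightarrow> 'a) \<Rightarrow> bool" where
  "assigned_meet_directoid m \<longleftrightarrow>
     (\<forall>x y. (x \<le> y \<longrightarrow> m x y = x) \<and>
            (y \<le> x \<longrightarrow> m x y = y) \<and>
            (\<not> x \<le> y \<and> \<not> y \<le> x \<longrightarrow> m x y = m y x \<and> m x y \<in> lower_cone x y))"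

definition dual_op :: "('a \<Rightarrow> 'a \<Rightarrow> 'a) \<Rightarrow> ('a \<Rightarrow> 'a) \<Rightarrow> 'a \<Rightarrow> 'a \<Rightarrow> 'a" where
  "dual_op m c x y = c (m (c x) (c y))"

end

theory Submission
  imports Defs
begin

text \<open>The idea is that a cone of \<open>P\<close>, although a set, is the range of a term of the directoid.
  The value \<open>(z \<sqinter> x) \<sqinter> (z \<sqinter> y)\<close> is a common lower bound of \<open>x\<close> and \<open>y\<close> whatever the
  choices made by \<open>\<sqinter>\<close>, and every common lower bound \<open>z\<close> arises in this way from itself, because
  \<open>\<sqinter>\<close> agrees with the meet on comparable pairs. Hence \<open>L(x,y)\<close> is the set of all values of that
  term (\<open>lower_cone_eq_range\<close>), and conjugation by an antitone involution turns this into the dual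
  description of \<open>U(x,y)\<close> (\<open>upper_cone_eq_range\<close>). For \<open>y = x'\<close>, the condition
  \<open>L(x,x') \<le> U(y,y')\<close> is therefore the third identity with \<open>z\<close> and \<open>w\<close> as parameters of the
  two ranges. The second identity expresses antitonicity (\<open>antimono_iff_meet_identity\<close>): any pair
  \<open>a \<le> b\<close> has the form \<open>x \<sqinter> y \<le> y\<close>.\<close>

lemma assigned_meet_le:
  assumes "assigned_meet_directoid m"
  shows "m x y \<le> x" and "m x y \<le> y"
proof -
  have "m x y \<in> lower_cone x y"
    using assms unfolding assigned_meet_directoid_def
    by (cases "x \<le> y \<or> y \<le> x") (auto simp: lower_cone_def)
  then show "m x y \<le> x" and "m x y \<le> y"
    by (simp_all add: lower_cone_def)
qed

lemma assigned_meet_absorb: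
  assumes "assigned_meet_directoid m" and "x \<le> y"
  shows "m x y = x" and "m y x = x"
  using assms by (simp_all add: assigned_meet_directoid_def)

lemma le_iff_assigned_meet:
  assumes "assigned_meet_directoid m"
  shows "x \<le> y \<longleftrightarrow> m x y = x" and "y \<le> x \<longleftrightarrow> m x y = y"
  using assigned_meet_le[OF assms, of x y] assigned_meet_absorb[OF assms] by auto

lemma antimono_iff_meet_identity:
  assumes m: "assigned_meet_directoid m"
  shows "antimono c \<longleftrightarrow> (\<forall>x y. m (c (m x y)) (c y) = c y)"
proof
  assume anti: "antimono c"
  have "c y \<le> c (m x y)" for x y
    by (rule antimonoD[OF anti assigned_meet_le(2)[OF m]])
  then show "\<forall>x y. m (c (m x y)) (c y) = c y"
    by (simp add: assigned_meet_absorb[OF m])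
next
  assume "\<forall>x y. m (c (m x y)) (c y) = c y"
  then have anti: "c y \<le> c (m x y)" for x y
    by (simp add: le_iff_assigned_meet(2)[OF m])
  show "antimono c"
  proof (rule antimonoI)
    fix x y :: 'a
    assume "x \<le> y"
    with anti[of y x] show "c y \<le> c x"
      by (simp add: assigned_meet_absorb[OF m])
  qed
qed

text \<open>The inner meets with \<open>x\<close> and \<open>y\<close> force the value below both; a common lower bound
  \<open>z\<close> is left fixed by all three meets.\<close>

lemma lower_cone_eq_range:
  assumes m: "assigned_meet_directoid m"
  shows "lower_cone x y = range (\<lambda>z. m (m z x) (m z y))"
proof
  show "lower_cone x y \<subseteq> range (\<lambda>z. m (m z x) (m z y))"
  proof
    fix a
    assume "a \<in> lower_cone x y"
    then have "m (m a x) (m a y) = a"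
      by (simp add: lower_cone_def assigned_meet_absorb[OF m])
    then show "a \<in> range (\<lambda>z. m (m z x) (m z y))"
      by (rule range_eqI[OF sym])
  qed
  show "range (\<lambda>z. m (m z x) (m z y)) \<subseteq> lower_cone x y"
  proof
    fix a
    assume "a \<in> range (\<lambda>z. m (m z x) (m z y))"
    then obtain z where a: "a = m (m z x) (m z y)"
      by blast
    have "a \<le> x"
      unfolding a by (rule order_trans[OF assigned_meet_le(1)[OF m] assigned_meet_le(2)[OF m]])
    moreover have "a \<le> y"
      unfolding a by (rule order_trans[OF assigned_meet_le(2)[OF m] assigned_meet_le(2)[OF m]])
    ultimately show "a \<in> lower_cone x y"
      by (simp add: lower_cone_def)
  qed
qed

lemma upper_cone_eq_image_lower_cone:
  assumes anti: "antimono c" and inv: "involution c"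
  shows "upper_cone x y = c ` lower_cone (c x) (c y)"
proof -
  have cc: "c (c a) = a" for a
    using inv by (simp add: involution_def)
  have le: "c a \<le> c b \<longleftrightarrow> b \<le> a" for a b
    using antimonoD[OF anti] cc by metis
  show ?thesis
  proof
    show "upper_cone x y \<subseteq> c ` lower_cone (c x) (c y)"
    proof
      fix b
      assume "b \<in> upper_cone x y"
      then have "c b \<in> lower_cone (c x) (c y)"
        by (simp add: upper_cone_def lower_cone_def le)
      then show "b \<in> c ` lower_cone (c x) (c y)"
        by (metis cc imageI)
    qed
    show "c ` lower_cone (c x) (c y) \<subseteq> upper_cone x y"
    proof
      fix b
      assume "b \<in> c ` lower_cone (c x) (c y)"
      then obtain a where "b = c a" "a \<le> c x" "a \<le> c y"
        by (auto simp: lower_cone_def)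
      then show "b \<in> upper_cone x y"
        using le[of "c x" a] le[of "c y" a] by (simp add: upper_cone_def cc)
    qed
  qed
qed

lemma upper_cone_eq_range:
  assumes m: "assigned_meet_directoid m" and anti: "antimono c" and inv: "involution c"
  shows "upper_cone x y = range (\<lambda>w. dual_op m c (dual_op m c w x) (dual_op m c w y))"
proof -
  have cc: "c (c a) = a" for a
    using inv by (simp add: involution_def)
  then have surj: "range c = UNIV"
    by (metis surjI)
  have "upper_cone x y = c ` range (\<lambda>z. m (m z (c x)) (m z (c y)))"
    by (simp add: upper_cone_eq_image_lower_cone[OF anti inv] lower_cone_eq_range[OF m])
  \<comment> \<open>The involution permutes \<open>P\<close>, so the parameter \<open>z\<close> may be taken to be \<open>c w\<close>.\<close>
  also have "\<dots> = c ` (\<lambda>z. m (m z (c x)) (m z (c y))) ` range c"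
    by (simp only: surj)
  also have "\<dots> = range (\<lambda>w. dual_op m c (dual_op m c w x) (dual_op m c w y))"
    by (simp add: image_image dual_op_def cc)
  finally show ?thesis .
qed

theorem theorem4p2:
  fixes c :: "'a::order \<Rightarrow> 'a"
    and meet :: "'a \<Rightarrow> 'a \<Rightarrow> 'a" (infixl "\<sqinter>" 70)
    and join :: "'a \<Rightarrow> 'a \<Rightarrow> 'a" (infixl "\<squnion>" 65)
  defines "join \<equiv> dual_op meet c"
  assumes "downward_directed TYPE('a)"
    and "assigned_meet_directoid meet"
  shows "pseudo_Kleene_poset c \<longleftrightarrow>
    (\<forall>x y z w.
       c (c x) = x \<and>
       c (x \<sqinter> y) \<sqinter> c y = c y \<and>
       (z \<sqinter> x) \<sqinter> (z \<sqinter> c x) \<le> (w \<squnion> y) \<squnion> (w \<squnion> c y))"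
proof -
  note m = \<open>assigned_meet_directoid meet\<close>
  have cones: "(\<forall>x y. set_le (lower_cone x (c x)) (upper_cone y (c y))) \<longleftrightarrow>
      (\<forall>x y z w. (z \<sqinter> x) \<sqinter> (z \<sqinter> c x) \<le> (w \<squnion> y) \<squnion> (w \<squnion> c y))"
    if "antimono c" and "involution c"
    unfolding set_le_def lower_cone_eq_range[OF m] upper_cone_eq_range[OF m that] join_def by fast
  have "pseudo_Kleene_poset c \<longleftrightarrow> antimono c \<and> involution c \<and>
      (\<forall>x y z w. (z \<sqinter> x) \<sqinter> (z \<sqinter> c x) \<le> (w \<squnion> y) \<squnion> (w \<squnion> c y))"
    unfolding pseudo_Kleene_poset_def by (simp only: cones cong: conj_cong)
  also have "\<dots> \<longleftrightarrow> (\<forall>x y z w.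
       c (c x) = x \<and>
       c (x \<sqinter> y) \<sqinter> c y = c y \<and>
       (z \<sqinter> x) \<sqinter> (z \<sqinter> c x) \<le> (w \<squnion> y) \<squnion> (w \<squnion> c y))"
    unfolding antimono_iff_meet_identity[OF m] involution_def by iprover
  finally show ?thesis .
qed

end
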